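(* Let $F$ be a regular flow on $\mathbb{R}^2$. Then $F$ admits a strict $C^0$ Lyapunov function.
   Context: A flow on $X=\mathbb{R}^2$ is a continuous map $F:\mathbb{R}\times X\to X$, $(t,x)\mapsto F^t(x)$, with $F^t(F^s(x))=F^{t+s}(x)$ and $F^0(x)=x$. The orbit of $q$ is $\mathcal{O}_F(q)=\{F^t(q):t\in\mathbb{R}\}$ and its forward orbit is $\mathcal{O}^+_F(q)=\{F^t(q):t\ge0\}$. Regular flow: $F$ is regular if it is locally topologically equivalent to the flow $G$ of a constant nonzero vector field, i.e. for every $p$ there are an open neighborhood $U_p$ of $p$ and a homeomorphism $\phi_p:U_p\to\mathbb{R}^2$ such that $\phi_p(\mathcal{O}_F(q)\cap U_p)=\mathcal{O}_G(\phi_p(q))$ for every $q\in U_p$. A strict $C^0$ Lyapunov function for $F$ is a continuous $L:X\to\mathbb{R}$ such that $y\in\mathcal{O}^+_F(x)$, $y\neq x$, implies $L(x)>L(y)$. *)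

theory Defs
  imports "HOL-Analysis.Analysis"
begin

definition is_flow :: "(real \<Rightarrow> 'a::topological_space \<Rightarrow> 'a) \<Rightarrow> bool" where
  "is_flow F \<longleftrightarrow>
     continuous_on UNIV (\<lambda>(t, x). F t x) \<and>
     (\<forall>s t x. F t (F s x) = F (t + s) x) \<and>
     (\<forall>x. F 0 x = x)"

definition orbit :: "(real \<Rightarrow> 'a \<Rightarrow> 'a) \<Rightarrow> 'a \<Rightarrow> 'a set" where
  "orbit F q = {F t q | t. True}"

definition forward_orbit :: "(real \<Rightarrow> 'a \<Rightarrow> 'a) \<Rightarrow> 'a \<Rightarrow> 'a set" where
  "forward_orbit F q = {F t q | t. t \<ge> 0}"

(* The flow of the constant vector field v: the solution of x' = v starting at x. *)
definition const_field_flow :: "'a::real_vector \<Rightarrow> real \<Rightarrow> 'a \<Rightarrow> 'a" where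
  "const_field_flow v t x = x + t *\<^sub>R v"

(* Only the unoriented orbits are compared. The whole trace of a global orbit on U,
   not just one of its connected components, corresponds to a single line. *)
definition regular_flow :: "(real \<Rightarrow> real^2 \<Rightarrow> real^2) \<Rightarrow> bool" where
  "regular_flow F \<longleftrightarrow>
     is_flow F \<and>
     (\<exists>v :: real^2. v \<noteq> 0 \<and>
       (\<forall>p. \<exists>U \<phi> \<psi>.
          open U \<and> p \<in> U \<and> homeomorphism U (UNIV :: (real^2) set) \<phi> \<psi> \<and>
          (\<forall>q\<in>U. \<phi> ` (orbit F q \<inter> U) = orbit (const_field_flow v) (\<phi> q))))"

definition strict_Lyapunov ::
    "(real \<Rightarrow> 'a::topological_space \<Rightarrow> 'a) \<Rightarrow> ('a \<Rightarrow> real) \<Rightarrow> bool" where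
  "strict_Lyapunov F L \<longleftrightarrow>
     continuous_on UNIV L \<and>
     (\<forall>x y. y \<in> forward_orbit F x \<and> y \<noteq> x \<longrightarrow> L x > L y)"

end

(* A regular planar flow has no fixed points, hence no periodic orbits, so every point has a
   transversal whose whole saturation is parametrised homeomorphically by the plane, and every
   orbit escapes to infinity. Sliding the transversal forward along the flow, more and more
   towards its ends, makes it a properly embedded line. The strip it sweeps out in unit time is
   then closed, and collapsing its complement to a point maps the plane to the circle, moving
   forward along orbits; a logarithm of this map is, up to sign, a Lyapunov function that is
   strict on the open strip. Countably many of these are summed. *)

theory Submission
  imports Defs
begin

section \<open>Continuous logarithms along closed curves\<close>

text \<open>Two values of \<open>f\<close> differ by a multiple of 2 pi i, so distinct ones are at
  least 2 pi apart, and a continuous map with such a discrete range is constant on a connected set.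
  Used to compare two logarithms of the same function.\<close>

lemma exp_constant_imp_constant:
  fixes f :: "'a::topological_space \<Rightarrow> complex"
  assumes "connected S" "continuous_on S f" "\<And>x. x \<in> S \<Longrightarrow> exp (f x) = k"
  shows "f constant_on S"
proof (rule continuous_discrete_range_constant[OF assms(1,2)])
  fix x assume x: "x \<in> S"
  have "2 * pi \<le> cmod (f y - f x)" if "y \<in> S" "f y \<noteq> f x" for y
  proof -
    have "exp (f y) = exp (f x)"
      using that x assms(3) by simp
    then obtain n :: int where n: "f y = f x + of_real (2 * of_int n * pi) * \<i>"
      unfolding exp_eq by auto
    have "n \<noteq> 0"
      using n that by auto
    then have "1 \<le> \<bar>real_of_int n\<bar>"
      by linarith
    then show ?thesis
      using n by (simp add: norm_mult abs_mult)
  qed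
  then show "\<exists>e>0. \<forall>y. y \<in> S \<and> f y \<noteq> f x \<longrightarrow> e \<le> cmod (f y - f x)"
    by (intro exI[of _ "2 * pi"]) auto
qed

text \<open>A weak form of Hopf's Umlaufsatz: the chord map \<open>u \<mapsto> \<gamma> (u + v) - \<gamma> u\<close> of a simple closed
  curve has odd winding number. Exchanging the end points of a chord, \<open>(u, v) \<mapsto> (u + v, T - v)\<close>,
  changes its sign, and doing so twice advances \<open>u\<close> by one period.\<close>

lemma no_periodic_chord_logarithm:
  fixes \<gamma> l :: "real \<Rightarrow> complex"
  assumes cont: "continuous_on UNIV \<gamma>"
    and per: "\<And>u. \<gamma> (u + T) = \<gamma> u"
    and simple: "\<And>u v. 0 < v \<Longrightarrow> v < T \<Longrightarrow> \<gamma> (u + v) \<noteq> \<gamma> u"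
    and w: "0 < w" "w < T"
    and contl: "continuous_on UNIV l"
    and expl: "\<And>u. exp (l u) = \<gamma> (u + w) - \<gamma> u"
  shows "l T \<noteq> l 0"
proof
  assume lT: "l T = l 0"
  \<comment> \<open>Chords are indexed by base point and length. The strip is convex, so a logarithm
    of the chord map exists on all of it, and it is invariant under the exchange of end
    points.\<close>
  define S :: "(real \<times> real) set" where "S = UNIV \<times> {0<..<T}"
  have "convex S"
    unfolding S_def by (intro convex_Times) auto
  have "continuous_on S (\<lambda>z. \<gamma> (fst z + snd z) - \<gamma> (fst z))"
    by (intro continuous_intros continuous_on_compose2[OF cont]) auto
  moreover have "\<And>z. z \<in> S \<Longrightarrow> \<gamma> (fst z + snd z) - \<gamma> (fst z) \<noteq> 0"
    using simple by (auto simp: S_def)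
  ultimately obtain \<theta> where cont\<theta>: "continuous_on S \<theta>"
    and \<theta>: "\<And>z. z \<in> S \<Longrightarrow> \<gamma> (fst z + snd z) - \<gamma> (fst z) = exp (\<theta> z)"
    by (rule continuous_logarithm_on_contractible[OF _ convex_imp_contractible[OF \<open>convex S\<close>]]) blast+
  have swap: "(u + v, T - v) \<in> S" if "(u, v) \<in> S" for u v
    using that by (auto simp: S_def)
  have "continuous_on S (\<lambda>z. \<theta> (fst z + snd z, T - snd z) - \<theta> z)"
    by (intro continuous_intros continuous_on_compose2[OF cont\<theta>] cont\<theta>) (auto simp: S_def)
  moreover have "exp (\<theta> (fst z + snd z, T - snd z) - \<theta> z) = -1" if "z \<in> S" for z
  proof -
    have "(fst z + snd z, T - snd z) \<in> S"
      using swap[of "fst z" "snd z"] that by simp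
    from \<theta>[OF this] have "exp (\<theta> (fst z + snd z, T - snd z)) = - exp (\<theta> z)"
      using \<theta>[OF that] per[of "fst z"] by (simp add: algebra_simps eq_neg_iff_add_eq_0)
    then show ?thesis
      by (simp add: exp_diff)
  qed
  ultimately have "(\<lambda>z. \<theta> (fst z + snd z, T - snd z) - \<theta> z) constant_on S"
    using exp_constant_imp_constant[OF convex_connected[OF \<open>convex S\<close>]] by blast
  then obtain c where c: "\<And>u v. (u, v) \<in> S \<Longrightarrow> \<theta> (u + v, T - v) - \<theta> (u, v) = c"
    unfolding constant_on_def by fastforce
  have inS: "(u, w) \<in> S" for u
    using w by (simp add: S_def)
  have "exp c = -1"
  proof -
    have "exp (\<theta> (0 + w, T - w)) = - exp (\<theta> (0, w))"
      using \<theta>[OF inS[of 0]] \<theta>[OF swap[OF inS[of 0]]] per[of 0] by simp (metis minus_diff_eq)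
    then show ?thesis
      by (simp only: c[OF inS[of 0], symmetric] exp_diff) simp
  qed
  \<comment> \<open>Two exchanges lead from (0, w) via (w, T - w) to (T, w), each adding
    \<open>c\<close>.\<close>
  have "\<theta> (T, w) - \<theta> (0, w) = 2 * c"
    using c[OF inS[of 0]] c[OF swap[OF inS[of 0]]] by (simp add: algebra_simps)
  \<comment> \<open>Along chords of length \<open>w\<close>, both \<open>\<theta>\<close> and
    \<open>l\<close> are logarithms of the same map, so they have the same increment over one
    period, which is 0 for \<open>l\<close>.\<close>
  moreover have "(\<lambda>u. \<theta> (u, w) - l u) constant_on UNIV"
  proof (rule exp_constant_imp_constant[where k = 1])
    show "continuous_on UNIV (\<lambda>u. \<theta> (u, w) - l u)"
      by (intro continuous_intros continuous_on_compose2[OF cont\<theta>] contl) (auto simp: inS)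
    show "exp (\<theta> (u, w) - l u) = 1" for u
      using \<theta>[OF inS[of u]] expl[of u] by (simp add: exp_diff)
  qed auto
  then have "\<theta> (T, w) - l T = \<theta> (0, w) - l 0"
    unfolding constant_on_def by auto
  ultimately have "c = 0"
    using lT by simp
  with \<open>exp c = -1\<close> show False
    by simp
qed

section \<open>Planar flows without fixed points have no periodic orbits\<close>

lemma flow_add: "is_flow F \<Longrightarrow> F t (F s x) = F (t + s) x"
  and flow_zero: "is_flow F \<Longrightarrow> F 0 x = x"
  by (auto simp: is_flow_def)

lemma continuous_on_flow:
  assumes "is_flow F" "continuous_on S f" "continuous_on S g"
  shows "continuous_on S (\<lambda>x. F (f x) (g x))"
proof -
  have "continuous_on UNIV (\<lambda>z. F (fst z) (snd z))"
    using assms(1) by (simp add: is_flow_def case_prod_unfold)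
  from continuous_on_compose2[OF this continuous_on_Pair[OF assms(2,3)]]
  show ?thesis by simp
qed

lemma tendsto_flow:
  fixes F :: "real \<Rightarrow> 'a::t2_space \<Rightarrow> 'a"
  assumes "is_flow F" "(f \<longlongrightarrow> a) A" "(g \<longlongrightarrow> x) A"
  shows "((\<lambda>y. F (f y) (g y)) \<longlongrightarrow> F a x) A"
proof -
  have "isCont (\<lambda>z. F (fst z) (snd z)) (a, x)"
    using assms(1) by (simp add: is_flow_def case_prod_unfold continuous_on_eq_continuous_at)
  from isCont_tendsto_compose[OF this tendsto_Pair[OF assms(2,3)]]
  show ?thesis by simp
qed

lemma flow_period_multiple:
  assumes F: "is_flow F" and per: "F s x = x"
  shows "F (of_int k * s) x = x"
proof -
  have nat: "F (of_nat n * s) x = x" for n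
    by (induction n) (simp_all add: flow_zero[OF F] distrib_right flow_add[OF F, symmetric] per)
  show ?thesis
  proof (cases "k \<ge> 0")
    case True
    then show ?thesis
      using nat[of "nat k"] by simp
  next
    case False
    have "F (of_int k * s) x = F (of_int k * s) (F (of_nat (nat (- k)) * s) x)"
      by (simp add: nat)
    also have "\<dots> = x"
      using False by (simp add: flow_add[OF F] flow_zero[OF F])
    finally show ?thesis .
  qed
qed

text \<open>Otherwise points of \<open>K\<close> with periods tending to 0 accumulate at some
  \<open>x\<close>. Any time \<open>a\<close> is a multiple of such a period up to an error tending
  to 0, so \<open>F a x = x\<close> for all \<open>a\<close>, making \<open>x\<close> a fixed
  point.\<close>

lemma no_small_periods:
  fixes F :: "real \<Rightarrow> 'a::metric_space \<Rightarrow> 'a"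
  assumes F: "is_flow F" and nofix: "\<And>x. \<exists>t. F t x \<noteq> x" and K: "compact K"
  obtains \<tau> where "\<tau> > 0" "\<And>x s. x \<in> K \<Longrightarrow> 0 < s \<Longrightarrow> s \<le> \<tau> \<Longrightarrow> F s x \<noteq> x"
proof (rule ccontr)
  assume neg: "\<not> thesis"
  have "\<exists>x s. x \<in> K \<and> 0 < s \<and> s \<le> 1 / (real n + 1) \<and> F s x = x" for n
    using neg that[of "1 / (real n + 1)"] by fastforce
  then obtain X s where X: "\<And>n. X n \<in> K" and s: "\<And>n. 0 < s n" "\<And>n. s n \<le> 1 / (real n + 1)"
    and Xs: "\<And>n. F (s n) (X n) = X n"
    by metis
  obtain x r where r: "strict_mono r" and lim: "(X \<circ> r) \<longlonglongrightarrow> x"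
    using K X unfolding compact_def by metis
  obtain a where a: "F a x \<noteq> x"
    using nofix by blast
  \<comment> \<open>The remainder of \<open>a\<close> modulo the period \<open>s n\<close>: flowing
    for time \<open>\<rho> n\<close> or \<open>a\<close> has the same effect on
    \<open>X n\<close>.\<close>
  define \<rho> where "\<rho> n = a - of_int \<lfloor>a / s n\<rfloor> * s n" for n
  have \<rho>: "0 \<le> \<rho> n" "\<rho> n \<le> s n" for n
    using s(1)[of n] floor_divide_lower[of "s n" a] floor_divide_upper[of "s n" a]
    by (auto simp: \<rho>_def algebra_simps)
  have "\<rho> \<longlonglongrightarrow> 0"
  proof (rule tendsto_sandwich)
    show "\<forall>\<^sub>F n in sequentially. 0 \<le> \<rho> n"
      using \<rho> by simp
    show "\<forall>\<^sub>F n in sequentially. \<rho> n \<le> 1 / (real n + 1)"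
      using \<rho> s(2) order_trans by (intro always_eventually) blast
    show "(\<lambda>n. 1 / (real n + 1)) \<longlonglongrightarrow> 0"
      using LIMSEQ_inverse_real_of_nat by (simp add: inverse_eq_divide add.commute)
  qed simp
  then have "(\<lambda>n. \<rho> (r n)) \<longlonglongrightarrow> 0"
    using LIMSEQ_subseq_LIMSEQ[OF _ r] by (auto simp: o_def)
  from tendsto_flow[OF F this lim]
  have "(\<lambda>n. F (\<rho> (r n)) (X (r n))) \<longlonglongrightarrow> x"
    by (simp add: flow_zero[OF F] o_def)
  moreover have "F (\<rho> n) (X n) = F a (X n)" for n
  proof -
    have "F a (X n) = F (\<rho> n) (F (of_int \<lfloor>a / s n\<rfloor> * s n) (X n))"
      by (simp add: flow_add[OF F] \<rho>_def)
    then show ?thesis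
      by (simp add: flow_period_multiple[OF F Xs])
  qed
  ultimately have "(\<lambda>n. F a (X (r n))) \<longlonglongrightarrow> x"
    by simp
  moreover have "(\<lambda>n. F a (X (r n))) \<longlonglongrightarrow> F a x"
    using tendsto_flow[OF F tendsto_const lim] by (simp add: o_def)
  ultimately show False
    using a LIMSEQ_unique by blast
qed

text \<open>In a disc around a periodic orbit, take \<open>\<tau>\<close> below all periods. The
  displacement from \<open>x\<close> to \<open>F \<tau> x\<close> vanishes nowhere on the disc and
  so has a logarithm there. Restricted to the orbit, this is a periodic logarithm of the chord map,
  which cannot exist.\<close>

lemma planar_flow_no_periodic_orbit:
  fixes F :: "real \<Rightarrow> real^2 \<Rightarrow> real^2"
  assumes F: "is_flow F" and nofix: "\<And>x. \<exists>t. F t x \<noteq> x" and "T > 0"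
  shows "F T q \<noteq> q"
proof
  assume T: "F T q = q"
  have "compact ((\<lambda>t. F t q) ` {0..T})"
    by (intro compact_continuous_image continuous_on_flow[OF F] continuous_intros) auto
  then obtain R where R: "(\<lambda>t. F t q) ` {0..T} \<subseteq> cball 0 R"
    using bounded_subset_ballD[OF compact_imp_bounded, of _ 0] ball_subset_cball
    by (meson order_trans)
  obtain \<tau> where \<tau>: "\<tau> > 0"
    and nosmall: "\<And>x s. x \<in> cball 0 R \<Longrightarrow> 0 < s \<Longrightarrow> s \<le> \<tau> \<Longrightarrow> F s x \<noteq> x"
    using no_small_periods[OF F nofix compact_cball[of 0 R]] by metis
  have q: "q \<in> cball 0 R"
    using R \<open>T > 0\<close> flow_zero[OF F, of q] by (force simp: image_subset_iff)
  \<comment> \<open>The cutoff at \<open>\<tau>\<close> loses no positive period of \<open>q\<close>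
    and keeps the set closed and away from 0, so its infimum is the least positive period.\<close>
  define P where "P = {s \<in> {\<tau>..}. F s q = q}"
  have "closed P"
    unfolding P_def
    by (intro continuous_closed_preimage_constant continuous_on_flow[OF F] continuous_intros closed_atLeast)
  have "\<tau> < T"
    using nosmall[OF q \<open>T > 0\<close>] T by force
  then have "T \<in> P"
    using T by (simp add: P_def)
  define T0 where "T0 = Inf P"
  have bdd: "bdd_below P"
    by (auto simp: P_def bdd_below_def)
  have "T0 \<in> P"
    unfolding T0_def using closed_contains_Inf[OF _ bdd \<open>closed P\<close>] \<open>T \<in> P\<close> by blast
  then have T0: "F T0 q = q" "\<tau> \<le> T0"
    by (auto simp: P_def)
  have "T0 \<le> T"
    unfolding T0_def by (rule cInf_lower[OF \<open>T \<in> P\<close> bdd])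
  have "T0 \<noteq> \<tau>"
    using nosmall[OF q \<tau>] T0 by auto
  with T0 have "\<tau> < T0" by simp
  have min: "F v q \<noteq> q" if "0 < v" "v < T0" for v
  proof
    assume v: "F v q = q"
    then have "\<tau> \<le> v"
      using nosmall[OF q that(1)] by force
    then have "v \<in> P"
      using v by (simp add: P_def)
    then have "T0 \<le> v"
      unfolding T0_def by (rule cInf_lower[OF _ bdd])
    with that show False by simp
  qed
  have per: "F (u + T0) q = F u q" for u
    using flow_add[OF F, of u T0 q] T0 by simp
  have simple: "F (u + v) q \<noteq> F u q" if "0 < v" "v < T0" for u v
  proof
    assume "F (u + v) q = F u q"
    then have "F (- u) (F (u + v) q) = F (- u) (F u q)"
      by simp
    then show False
      using min[OF that] by (simp add: flow_add[OF F] flow_zero[OF F])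
  qed
  have orbit: "F u q \<in> cball 0 R" for u
  proof -
    define k where "k = \<lfloor>u / T0\<rfloor>"
    define r where "r = u - of_int k * T0"
    have pos: "T0 > 0"
      using \<tau> T0 by simp
    have "0 \<le> r" "r \<le> T0"
      using floor_divide_lower[OF pos, of u] floor_divide_upper[OF pos, of u]
      by (auto simp: r_def k_def algebra_simps)
    then have "F r q \<in> cball 0 R"
      using R \<open>T0 \<le> T\<close> by (auto simp: image_subset_iff)
    moreover have "F u q = F r (F (of_int k * T0) q)"
      by (simp add: flow_add[OF F] r_def)
    ultimately show ?thesis
      by (simp add: flow_period_multiple[OF F T0(1)])
  qed
  define C :: "real^2 \<Rightarrow> complex" where "C y = of_real (y $ 1) + \<i> * of_real (y $ 2)" for y
  have contC: "continuous_on S (\<lambda>x. C (f x))" if "continuous_on S f" for S and f :: "'b::topological_space \<Rightarrow> real^2"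
    unfolding C_def by (intro continuous_intros that)
  have C_eq: "C x = C y \<longleftrightarrow> x = y" for x y
    by (auto simp: C_def complex_eq_iff vec_eq_iff forall_2)
  have "continuous_on (cball 0 R) (\<lambda>x. C (F \<tau> x) - C x)"
    by (intro continuous_intros contC continuous_on_flow[OF F])
  moreover have "C (F \<tau> x) - C x \<noteq> 0" if "x \<in> cball 0 R" for x
    using nosmall[OF that \<tau>] C_eq by simp
  ultimately obtain G where contG: "continuous_on (cball 0 R) G"
    and G: "\<And>x. x \<in> cball 0 R \<Longrightarrow> C (F \<tau> x) - C x = exp (G x)"
    by (rule continuous_logarithm_on_cball) blast+
  \<comment> \<open>Chords cut off by the time step \<open>\<tau>\<close> have the fixed parameter
    length \<open>w = \<tau>\<close>, and \<open>G\<close> along the orbit is their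
    logarithm.\<close>
  have "G (F T0 q) \<noteq> G (F 0 q)"
  proof (rule no_periodic_chord_logarithm[where \<gamma> = "\<lambda>u. C (F u q)" and w = \<tau>])
    show "continuous_on UNIV (\<lambda>u. C (F u q))"
      by (intro contC continuous_on_flow[OF F] continuous_intros)
    show "continuous_on UNIV (\<lambda>u. G (F u q))"
      by (rule continuous_on_compose2[OF contG])
        (use orbit in \<open>auto intro!: continuous_on_flow[OF F] continuous_intros\<close>)
    show "exp (G (F u q)) = C (F (u + \<tau>) q) - C (F u q)" for u
      using G[OF orbit[of u]] by (simp add: flow_add[OF F] add.commute)
  qed (use \<tau> \<open>\<tau> < T0\<close> per simple C_eq in auto)
  then show False
    by (simp add: T0 flow_zero[OF F])
qed

section \<open>Flow boxes and escaping orbits of regular flows\<close>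

text \<open>A chart sends the trace of an orbit onto a line in direction \<open>v\<close>, never a
  single point, so there are no fixed points and the planar result applies. Negative
  \<open>T\<close> is reduced to \<open>- T\<close>.\<close>

lemma regular_flow_no_periodic_orbit:
  assumes "regular_flow F" "T \<noteq> 0"
  shows "F T q \<noteq> q"
proof -
  obtain v where F: "is_flow F" and "v \<noteq> 0" and chart: "\<And>p. \<exists>U \<phi> \<psi>. open U \<and> p \<in> U \<and>
      homeomorphism U (UNIV :: (real^2) set) \<phi> \<psi> \<and>
      (\<forall>q\<in>U. \<phi> ` (orbit F q \<inter> U) = orbit (const_field_flow v) (\<phi> q))"
    using assms(1) unfolding regular_flow_def by blast
  have nofix: "\<exists>t. F t x \<noteq> x" for x
  proof (rule ccontr)
    assume "\<nexists>t. F t x \<noteq> x"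
    then have orb: "orbit F x = {x}"
      by (auto simp: orbit_def)
    obtain U \<phi> where "x \<in> U" and U: "\<phi> ` (orbit F x \<inter> U) = orbit (const_field_flow v) (\<phi> x)"
      using chart[of x] by blast
    have "\<phi> x + 1 *\<^sub>R v \<in> orbit (const_field_flow v) (\<phi> x)"
      unfolding orbit_def const_field_flow_def by blast
    also have "\<dots> = {\<phi> x}"
      using U orb \<open>x \<in> U\<close> by simp
    finally show False
      using \<open>v \<noteq> 0\<close> by simp
  qed
  show ?thesis
  proof (cases "T > 0")
    case True
    then show ?thesis
      by (rule planar_flow_no_periodic_orbit[OF F nofix])
  next
    case False
    then have "F (- T) q \<noteq> q"
      using assms(2) by (intro planar_flow_no_periodic_orbit[OF F nofix]) simp
    then show ?thesis
      using flow_add[OF F, of "- T" T q] flow_zero[OF F, of q] by auto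
  qed
qed

text \<open>In a chart, traces of orbits are whole parallel lines, hence relatively closed. The
  transversal is the preimage of a perpendicular line: each orbit meets it at most once because its
  entire trace is a single line, and at a unique time because no orbit is periodic.\<close>

lemma regular_flow_box:
  assumes reg: "regular_flow F"
  obtains U \<sigma> where "open U" "p \<in> U"
    "\<And>q. q \<in> U \<Longrightarrow> closedin (top_of_set U) (orbit F q \<inter> U)"
    "continuous_on UNIV \<sigma>" "\<sigma> (0::real) = p" "inj (\<lambda>(t, s). F t (\<sigma> s))"
proof -
  obtain v U \<phi> \<psi> where F: "is_flow F" and v: "v \<noteq> 0" and U: "open U" "p \<in> U"
    and hom: "homeomorphism U (UNIV :: (real^2) set) \<phi> \<psi>"
    and orb: "\<And>q. q \<in> U \<Longrightarrow> \<phi> ` (orbit F q \<inter> U) = orbit (const_field_flow v) (\<phi> q)"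
    using reg unfolding regular_flow_def by metis
  have \<psi>U: "\<psi> y \<in> U" and \<phi>\<psi>: "\<phi> (\<psi> y) = y" for y
    using hom by (auto simp: homeomorphism_def)
  have \<psi>\<phi>: "\<psi> (\<phi> x) = x" if "x \<in> U" for x
    using hom that by (auto simp: homeomorphism_def)
  have cont: "continuous_on U \<phi>" "continuous_on UNIV \<psi>"
    using hom by (auto simp: homeomorphism_def)
  \<comment> \<open>The direction \<open>v\<close> turned by a right angle.\<close>
  define w :: "real^2" where "w = vector [- (v $ 2), v $ 1]"
  have perp: "w \<bullet> v = 0"
    by (simp add: w_def inner_vec_def sum_2)
  have ww: "w \<bullet> w > 0"
    using v by (auto simp: w_def vec_eq_iff forall_2 inner_vec_def sum_2 sum_power2_gt_zero_iff
        simp flip: power2_eq_square)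
  define \<sigma> where "\<sigma> s = \<psi> (\<phi> p + s *\<^sub>R w)" for s
  show thesis
  proof
    show "closedin (top_of_set U) (orbit F q \<inter> U)" if q: "q \<in> U" for q
    proof -
      have "orbit (const_field_flow v) (\<phi> q) = (+) (\<phi> q) ` span {v}"
        by (auto simp: orbit_def const_field_flow_def span_singleton)
      then have "closed (orbit (const_field_flow v) (\<phi> q))"
        by (simp add: closed_translation)
      then have "closedin (top_of_set U) (U \<inter> \<phi> -` orbit (const_field_flow v) (\<phi> q))"
        by (rule continuous_closedin_preimage[OF cont(1)])
      also have "U \<inter> \<phi> -` orbit (const_field_flow v) (\<phi> q) = orbit F q \<inter> U"
        unfolding orb[OF q, symmetric] by (auto) (metis \<psi>\<phi>)
      finally show ?thesis .
    qed
    show "continuous_on UNIV \<sigma>"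
      unfolding \<sigma>_def by (intro continuous_on_compose2[OF cont(2)] continuous_intros) auto
    show "\<sigma> 0 = p"
      using U \<psi>\<phi> by (simp add: \<sigma>_def)
    show "inj (\<lambda>(t, s). F t (\<sigma> s))"
    proof (rule injI, clarify)
      fix t s t' s'
      assume eq: "F t (\<sigma> s) = F t' (\<sigma> s')"
      then have "F (- t') (F t (\<sigma> s)) = F (- t') (F t' (\<sigma> s'))"
        by simp
      then have s': "\<sigma> s' = F (t - t') (\<sigma> s)"
        by (simp add: flow_add[OF F] flow_zero[OF F])
      moreover have "\<sigma> s' \<in> U"
        by (simp add: \<sigma>_def \<psi>U)
      ultimately have "\<sigma> s' \<in> orbit F (\<sigma> s) \<inter> U"
        by (auto simp: orbit_def)
      \<comment> \<open>However long the orbit stays outside \<open>U\<close> in between, its return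
        lies on the same line; the inner product with \<open>w\<close> then identifies the
        transversal parameters.\<close>
      then have "\<phi> (\<sigma> s') \<in> orbit (const_field_flow v) (\<phi> (\<sigma> s))"
        using orb[of "\<sigma> s"] \<psi>U[of "\<phi> p + s *\<^sub>R w"] unfolding \<sigma>_def[symmetric] by blast
      then obtain a where "s' *\<^sub>R w = s *\<^sub>R w + a *\<^sub>R v"
        by (auto simp: \<sigma>_def \<phi>\<psi> orbit_def const_field_flow_def)
      then have "w \<bullet> (s' *\<^sub>R w) = w \<bullet> (s *\<^sub>R w + a *\<^sub>R v)"
        by simp
      then have "s' = s"
        using ww perp by (simp add: inner_add_right)
      with s' regular_flow_no_periodic_orbit[OF reg, of "t - t'" "\<sigma> s"] show "t = t' \<and> s = s'"
        by force
    qed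
  qed (use U in auto)
qed

text \<open>An accumulation point of a forward orbit would lie on the orbit, which could then return to
  the flow box around it only at times close to \<open>0\<close>.\<close>

lemma regular_flow_escapes:
  assumes reg: "regular_flow F"
  shows "filterlim (\<lambda>t. F t q) at_infinity at_top"
proof (rule ccontr)
  have F: "is_flow F"
    using reg by (simp add: regular_flow_def)
  assume "\<not> filterlim (\<lambda>t. F t q) at_infinity at_top"
  then obtain R where R: "\<not> (\<forall>\<^sub>F t in at_top. R \<le> norm (F t q))"
    by (auto simp: filterlim_at_infinity[of 0])
  have "\<exists>t\<ge>real n. F t q \<in> cball 0 R" for n
    using R unfolding eventually_at_top_linorder by (force simp: not_le)
  then obtain t where t: "\<And>n. real n \<le> t n" and tR: "\<And>n. F (t n) q \<in> cball 0 R"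
    by metis
  obtain x r where r: "strict_mono r" and lim0: "((\<lambda>n. F (t n) q) \<circ> r) \<longlonglongrightarrow> x"
    using compact_cball[of "0::real^2" R] tR unfolding compact_def by meson
  define s where "s n = t (r n)" for n
  have lim: "(\<lambda>n. F (s n) q) \<longlonglongrightarrow> x"
    using lim0 by (simp add: o_def s_def)
  have s: "filterlim s at_top sequentially"
  proof (rule filterlim_at_top_mono[OF filterlim_real_sequentially])
    have "real n \<le> s n" for n
      using t[of "r n"] seq_suble[OF r, of n] unfolding s_def by linarith
    then show "\<forall>\<^sub>F n in sequentially. real n \<le> s n"
      by simp
  qed
  obtain U \<sigma> where U: "open U" "x \<in> U"
    and clo: "\<And>q. q \<in> U \<Longrightarrow> closedin (top_of_set U) (orbit F q \<inter> U)"
    and \<sigma>: "continuous_on UNIV \<sigma>" "\<sigma> (0::real) = x" and inj: "inj (\<lambda>(t, s). F t (\<sigma> s))"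
    using regular_flow_box[OF reg, of x] by blast
  \<comment> \<open>All late points lie in the relatively closed trace of one orbit, so their limit
    \<open>x\<close> does too.\<close>
  have ev: "\<forall>\<^sub>F n in sequentially. F (s n) q \<in> U"
    using topological_tendstoD[OF lim U] .
  then obtain N where N: "F (s N) q \<in> U"
    by (auto simp: eventually_sequentially)
  obtain D where D: "closed D" "orbit F (F (s N) q) \<inter> U = U \<inter> D"
    using clo[OF N] by (auto simp: closedin_closed)
  have "F (s n) q \<in> orbit F (F (s N) q)" for n
    by (auto simp: orbit_def flow_add[OF F] intro!: exI[of _ "s n - s N"])
  then have "\<forall>\<^sub>F n in sequentially. F (s n) q \<in> D"
    using ev D by (auto elim!: eventually_mono)
  then have "x \<in> D"
    using Lim_in_closed_set[OF D(1) _ _ lim] by simp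
  then have "x \<in> orbit F (F (s N) q)"
    using D U by blast
  then obtain a where a: "x = F a q"
    by (auto simp: orbit_def flow_add[OF F])
  define \<Phi> where "\<Phi> = (\<lambda>z. F (fst z) (\<sigma> (snd z)))"
  have inj\<Phi>: "inj \<Phi>"
    using inj by (simp add: \<Phi>_def case_prod_unfold)
  have cont\<Phi>: "continuous_on UNIV \<Phi>"
    unfolding \<Phi>_def
    by (intro continuous_on_flow[OF F] continuous_on_compose2[OF \<sigma>(1)] continuous_intros) auto
  \<comment> \<open>By invariance of domain the box coordinates are continuous. Hence the time
    coordinates \<open>s n - a\<close> tend to that of \<open>x\<close>, namely 0, although
    \<open>s\<close> is unbounded.\<close>
  have "continuous_on (range \<Phi>) (inv \<Phi>)"
    by (rule continuous_on_inverse_open[OF open_UNIV cont\<Phi>]) (simp_all add: inj\<Phi>)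
  moreover have \<Phi>s: "F (s n) q = \<Phi> (s n - a, 0)" for n
    by (simp add: \<Phi>_def \<sigma> a flow_add[OF F])
  moreover have x\<Phi>: "x = \<Phi> (0, 0)"
    by (simp add: \<Phi>_def \<sigma> flow_zero[OF F])
  ultimately have "(\<lambda>n. inv \<Phi> (F (s n) q)) \<longlonglongrightarrow> inv \<Phi> x"
    by (intro continuous_on_tendsto_compose[OF _ lim]) auto
  then have "(\<lambda>n. (s n - a, 0::real)) \<longlonglongrightarrow> (0, 0)"
    unfolding \<Phi>s x\<Phi> by (simp add: inj\<Phi>)
  then have "(\<lambda>n. s n - a) \<longlonglongrightarrow> 0"
    using tendsto_fst by fastforce
  then have "(\<lambda>n. (s n - a) + a) \<longlonglongrightarrow> 0 + a"
    by (intro tendsto_intros)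
  then have "s \<longlonglongrightarrow> a"
    by simp
  with s show False
    using filterlim_at_top_imp_at_infinity not_tendsto_and_filterlim_at_infinity
      trivial_limit_sequentially by blast
qed

section \<open>A Lyapunov function that is strict near a given point\<close>

text \<open>The height \<open>h\<close> grows so slowly that the orbit through \<open>\<sigma> (arctan r)\<close> stays close to the one
  through the end point \<open>\<sigma> (\<plusminus> pi / 2)\<close> up to time \<open>h r + 1\<close>, and the latter orbit escapes.\<close>

lemma regular_flow_proper_section:
  assumes reg: "regular_flow F" and \<sigma>: "continuous_on UNIV (\<sigma> :: real \<Rightarrow> real^2)"
  obtains h :: "real \<Rightarrow> real" where "continuous_on UNIV h" "h 0 = - 1 / 2"
    "\<And>R. \<exists>M. \<forall>r u. M < \<bar>r\<bar> \<longrightarrow> u \<in> {0..1} \<longrightarrow> R < norm (F (h r + u) (\<sigma> (arctan r)))"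
proof -
  have F: "is_flow F"
    using reg by (simp add: regular_flow_def)
  define e where "e r = sgn r * (pi / 2)" for r :: real
  \<comment> \<open>Pairs (r, t) at which the two orbits are at least 1 apart at time
    \<open>t\<close>. The extra point (0, 0) makes \<open>B\<close> nonempty and forces
    \<open>d 0 = 0\<close>, hence the value of \<open>h 0\<close>.\<close>
  define B where "B = insert (0, 0) {(r, t). 1 \<le> dist (F t (\<sigma> (arctan r))) (F t (\<sigma> (e r)))}"
  \<comment> \<open>A distance function is continuous although \<open>e\<close> jumps at 0, and the
    two orbits stay within 1 of each other for all times below \<open>d r\<close> in absolute
    value.\<close>
  define d where "d r = infdist (r, 0) B" for r :: real
  \<comment> \<open>Halving gives \<open>h r + 1 < d r\<close> as soon as \<open>d r > 1\<close>,
    while \<open>h\<close> still tends to infinity with \<open>d\<close>.\<close>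
  define h where "h r = (d r - 1) / 2" for r
  have B: "B \<noteq> {}" "(0, 0) \<in> B"
    by (auto simp: B_def)
  have close: "dist (F t (\<sigma> (arctan r))) (F t (\<sigma> (e r))) < 1" if "\<bar>t\<bar> < d r" for r t
  proof (rule ccontr)
    assume "\<not> ?thesis"
    then have "(r, t) \<in> B"
      by (simp add: B_def)
    then have "d r \<le> dist (r, 0) (r, t)"
      unfolding d_def by (rule infdist_le)
    with that show False
      by (simp add: dist_Pair_Pair dist_real_def)
  qed
  have d_large: "\<exists>M. \<forall>r. M < \<bar>r\<bar> \<longrightarrow> T \<le> d r" if "T > 0" for T
  proof -
    define K :: "(real \<times> real) set" where "K = {- T..T} \<times> {- pi / 2..pi / 2}"
    have "uniformly_continuous_on K (\<lambda>z. F (fst z) (\<sigma> (snd z)))"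
      unfolding K_def by (intro compact_uniformly_continuous compact_Times continuous_on_flow[OF F]
          continuous_on_compose2[OF \<sigma>] continuous_intros) auto
    then obtain \<delta> where \<delta>: "\<delta> > 0" "\<And>z z'. z \<in> K \<Longrightarrow> z' \<in> K \<Longrightarrow> dist z' z < \<delta> \<Longrightarrow>
        dist (F (fst z') (\<sigma> (snd z'))) (F (fst z) (\<sigma> (snd z))) < 1"
      unfolding uniformly_continuous_on_def by (metis zero_less_one)
    have "\<forall>\<^sub>F r in at_top. dist (arctan r) (pi / 2) < \<delta>"
      using tendsto_arctan_at_top \<delta>(1) by (rule tendstoD)
    then obtain M1 where M1: "\<And>r. M1 \<le> r \<Longrightarrow> dist (arctan r) (pi / 2) < \<delta>"
      by (auto simp: eventually_at_top_linorder)
    have far: "dist (arctan r) (e r) < \<delta>" if "max M1 1 \<le> \<bar>r\<bar>" for r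
      using M1[of "\<bar>r\<bar>"] that
      by (cases "r > 0") (auto simp: e_def sgn_if arctan_minus dist_real_def abs_if split: if_splits)
    \<comment> \<open>The margin \<open>T\<close> ensures that every (r', t) closer than
      \<open>T\<close> to (r, 0) still has r' in the range where \<open>far\<close> and uniform
      continuity exclude it from \<open>B\<close>.\<close>
    have "T \<le> d r" if r: "max M1 1 + T < \<bar>r\<bar>" for r
      unfolding d_def infdist_notempty[OF B(1)]
    proof (rule cINF_greatest[OF B(1)], clarify)
      fix r' t assume "(r', t) \<in> B"
      show "T \<le> dist (r, 0) (r', t)"
      proof (rule ccontr)
        assume "\<not> ?thesis"
        then have lt: "dist r r' < T" "\<bar>t\<bar> < T"
          using dist_fst_le[of "(r, 0)" "(r', t)"] dist_snd_le[of "(r, 0)" "(r', t)"]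
          by (auto simp: dist_real_def)
        then have r': "max M1 1 < \<bar>r'\<bar>"
          using r by (auto simp: dist_real_def)
        then have "\<not> dist (F t (\<sigma> (arctan r'))) (F t (\<sigma> (e r'))) < 1"
          using \<open>(r', t) \<in> B\<close> by (auto simp: B_def)
        moreover have "(t, arctan r') \<in> K" "(t, e r') \<in> K"
          using lt arctan_bounded[of r'] by (auto simp: K_def e_def sgn_if)
        ultimately show False
          using \<delta>(2)[of "(t, e r')" "(t, arctan r')"] far[of r'] r'
          by (auto simp: dist_Pair_Pair)
      qed
    qed
    then show ?thesis
      by blast
  qed
  show thesis
  proof
    show "continuous_on UNIV h"
      unfolding h_def d_def by (intro continuous_intros) auto
    show "h 0 = - 1 / 2"
      using B by (simp add: h_def d_def)
    fix R :: real
    \<comment> \<open>The surplus 1 pays for the distance between the orbit of the end point and its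
      neighbour.\<close>
    have "\<exists>T. \<forall>t\<ge>T. R + 1 < norm (F t q)" for q
      using regular_flow_escapes[OF reg, of q]
      by (auto simp: filterlim_at_infinity_conv_norm_at_top filterlim_at_top_dense
          eventually_at_top_linorder)
    then obtain T where T: "\<And>q t. T q \<le> t \<Longrightarrow> R + 1 < norm (F t q)"
      by metis
    define T0 where "T0 = max 1 (max (T (\<sigma> (pi / 2))) (T (\<sigma> (- pi / 2))))"
    have "0 < 2 * T0 + 1"
      by (auto simp: T0_def)
    then obtain M where M: "\<And>r. M < \<bar>r\<bar> \<Longrightarrow> 2 * T0 + 1 \<le> d r"
      using d_large by blast
    have "R < norm (F (h r + u) (\<sigma> (arctan r)))" if "max M 0 < \<bar>r\<bar>" "u \<in> {0..1}" for r u
    proof -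
      have "2 * T0 + 1 \<le> d r" "1 \<le> T0"
        using M[of r] that by (auto simp: T0_def)
      then have "\<bar>h r + u\<bar> < d r" and "T0 \<le> h r + u"
        using that by (auto simp: h_def abs_less_iff field_simps)
      moreover have "T (\<sigma> (e r)) \<le> T0"
        using that by (auto simp: T0_def e_def sgn_if)
      ultimately show ?thesis
        using close[of "h r + u" r] T[of "\<sigma> (e r)" "h r + u"]
          norm_triangle_ineq2[of "F (h r + u) (\<sigma> (e r))" "F (h r + u) (\<sigma> (arctan r))"]
        by (simp add: dist_norm norm_minus_commute)
    qed
    then show "\<exists>M. \<forall>r u. M < \<bar>r\<bar> \<longrightarrow> u \<in> {0..1} \<longrightarrow> R < norm (F (h r + u) (\<sigma> (arctan r)))"
      by blast
  qed
qed

text \<open>\<open>V\<close> is the open unit-time strip over the properly embedded section. The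
  lifted angle rises by 2 pi across the strip and is constant along the rest of each orbit; its
  negative is the required function.\<close>

lemma regular_flow_local_Lyapunov:
  assumes reg: "regular_flow F"
  obtains V and L :: "real^2 \<Rightarrow> real" where "open V" "p \<in> V" "continuous_on UNIV L"
    "\<And>x t. 0 \<le> t \<Longrightarrow> L (F t x) \<le> L x"
    "\<And>x t. x \<in> V \<Longrightarrow> 0 < t \<Longrightarrow> L (F t x) < L x"
proof -
  have F: "is_flow F"
    using reg by (simp add: regular_flow_def)
  obtain U \<sigma> where \<sigma>: "continuous_on UNIV \<sigma>" "\<sigma> (0::real) = p" and inj: "inj (\<lambda>(t, s). F t (\<sigma> s))"
    using regular_flow_box[OF reg, of p] by blast
  obtain h where h: "continuous_on UNIV h" "h 0 = - 1 / 2"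
    and proper: "\<And>R. \<exists>M. \<forall>r u. M < \<bar>r\<bar> \<longrightarrow> u \<in> {0..1} \<longrightarrow> R < norm (F (h r + u) (\<sigma> (arctan r)))"
    using regular_flow_proper_section[OF reg \<sigma>(1)] by blast
  \<comment> \<open>The flow box over the parameters between - pi / 2 and pi / 2, sheared by
    \<open>h\<close>: the line \<open>u = 0\<close> is the slid section, the flow adds
    \<open>t\<close> to \<open>u\<close>, and \<open>h 0\<close> puts \<open>p\<close> at
    \<open>u = 1 / 2\<close>, inside the strip.\<close>
  define \<Psi> where "\<Psi> = (\<lambda>z. F (h (fst z) + snd z) (\<sigma> (arctan (fst z))))"
  have cont\<Psi>: "continuous_on S \<Psi>" for S
    unfolding \<Psi>_def
    by (intro continuous_on_flow[OF F] continuous_on_compose2[OF \<sigma>(1)]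
        continuous_on_compose2[OF h(1)] continuous_intros) auto
  have inj\<Psi>: "inj \<Psi>"
  proof (rule injI)
    fix z z' assume "\<Psi> z = \<Psi> z'"
    then have "(h (fst z) + snd z, arctan (fst z)) = (h (fst z') + snd z', arctan (fst z'))"
      by (intro injD[OF inj]) (simp add: \<Psi>_def)
    then show "z = z'"
      by (auto simp: arctan_eq_iff prod_eq_iff)
  qed
  define V where "V = \<Psi> ` (UNIV \<times> {0<..<1})"
  define S where "S = \<Psi> ` (UNIV \<times> {0..1})"
  have "open V"
    unfolding V_def
    by (rule invariance_of_domain_gen) (auto intro: cont\<Psi> open_Times inj_on_subset[OF inj\<Psi>])
  have "p \<in> V"
    unfolding V_def by (rule image_eqI[of _ _ "(0, 1 / 2)"]) (auto simp: \<Psi>_def h \<sigma> flow_zero[OF F])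
  \<comment> \<open>A convergent sequence in \<open>S\<close> is bounded, so properness confines its
    first coordinates to a compact interval, and the image of a compact rectangle is closed.\<close>
  have "closed S"
    unfolding closed_sequential_limits
  proof clarify
    fix X x assume X: "\<forall>n. X n \<in> S" and lim: "X \<longlonglongrightarrow> x"
    from lim have "bounded (range X)"
      by (rule convergent_imp_bounded)
    then obtain R where R: "\<And>n. norm (X n) \<le> R"
      by (auto simp: bounded_iff)
    obtain M where M: "\<And>r u. M < \<bar>r\<bar> \<Longrightarrow> u \<in> {0..1} \<Longrightarrow> R < norm (\<Psi> (r, u))"
      using proper[of R] by (auto simp: \<Psi>_def)
    have "closed (\<Psi> ` ({- M..M} \<times> {0..1}))"
      by (intro compact_imp_closed compact_continuous_image cont\<Psi> compact_Times) auto
    moreover have "X n \<in> \<Psi> ` ({- M..M} \<times> {0..1})" for n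
    proof -
      obtain r u where ru: "X n = \<Psi> (r, u)" "u \<in> {0..1}"
        using X by (force simp: S_def)
      then have "\<not> M < \<bar>r\<bar>"
        using M[of r u] R[of n] by auto
      with ru show ?thesis
        by (intro image_eqI[of _ _ "(r, u)"]) auto
    qed
    ultimately have "x \<in> \<Psi> ` ({- M..M} \<times> {0..1})"
      using lim closed_sequentially by blast
    then show "x \<in> S"
      by (auto simp: S_def)
  qed
  define f where "f x = (if x \<in> S then exp (2 * pi * \<i> * of_real (snd (inv \<Psi> x))) else 1)" for x
  have f\<Psi>: "f (\<Psi> (r, u)) = exp (2 * pi * \<i> * of_real (max 0 (min 1 u)))" for r u
  proof -
    have "\<Psi> (r, u) \<in> S \<longleftrightarrow> u \<in> {0..1}"
      unfolding S_def by (subst inj_image_mem_iff[OF inj\<Psi>]) auto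
    then show ?thesis
      by (auto simp: f_def inj\<Psi> max_def min_def)
  qed
  have "continuous_on (range \<Psi>) (inv \<Psi>)"
    by (rule continuous_on_inverse_open[OF open_UNIV cont\<Psi>]) (simp_all add: inj\<Psi>)
  then have cont_inv: "continuous_on S (inv \<Psi>)"
    by (rule continuous_on_subset) (auto simp: S_def)
  \<comment> \<open>The two closed pieces overlap exactly in the edges \<open>u = 0\<close> and
    \<open>u = 1\<close> of the strip, where the exponential equals 1 as well.\<close>
  have "continuous_on (S \<union> - V) f"
    unfolding f_def
  proof (rule continuous_on_cases[OF \<open>closed S\<close>])
    show "closed (- V)"
      using \<open>open V\<close> by (rule closed_Compl)
    show "continuous_on S (\<lambda>x. exp (2 * pi * \<i> * of_real (snd (inv \<Psi> x))))"
      by (intro continuous_intros cont_inv)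
    have "exp (2 * pi * \<i> * of_real (snd (inv \<Psi> x))) = 1" if "x \<in> S" "x \<notin> V" for x
    proof -
      obtain r u where ru: "x = \<Psi> (r, u)" "u \<in> {0..1}"
        using \<open>x \<in> S\<close> by (auto simp: S_def)
      with \<open>x \<notin> V\<close> have "u = 0 \<or> u = 1"
        by (force simp: V_def)
      with ru show ?thesis
        by (auto simp: inj\<Psi>)
    qed
    then show "\<forall>x. x \<in> S \<and> x \<notin> S \<or> x \<in> - V \<and> x \<in> S \<longrightarrow>
        exp (2 * pi * \<i> * of_real (snd (inv \<Psi> x))) = 1"
      by blast
  qed auto
  moreover have "S \<union> - V = UNIV"
    by (force simp: S_def V_def)
  ultimately have "continuous_on UNIV f"
    by simp
  moreover have "f x \<noteq> 0" for x
    by (simp add: f_def)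
  ultimately obtain l where contl: "continuous_on UNIV l" and l: "\<And>x. f x = exp (l x)"
    using continuous_logarithm_on_contractible[OF _ convex_imp_contractible[OF convex_UNIV]]
    by (metis UNIV_I)
  have contlF: "continuous_on UNIV (\<lambda>t. l (F t x))" for x
    by (intro continuous_on_compose2[OF contl] continuous_on_flow[OF F] continuous_intros) auto
  \<comment> \<open>On each orbit through the strip, the clamped coordinate times 2 pi i is an
    explicit logarithm of \<open>f\<close>, so \<open>l\<close> differs from it by a constant that
    may depend on \<open>r\<close>.\<close>
  have strip: "\<exists>c. \<forall>u. Im (l (\<Psi> (r, u))) = c + 2 * pi * max 0 (min 1 u)" for r
  proof -
    have "(\<lambda>u. l (\<Psi> (r, u)) - 2 * pi * \<i> * of_real (max 0 (min 1 u))) constant_on UNIV"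
    proof (rule exp_constant_imp_constant[where k = 1])
      show "continuous_on UNIV (\<lambda>u. l (\<Psi> (r, u)) - 2 * pi * \<i> * of_real (max 0 (min 1 u)))"
        by (intro continuous_intros continuous_on_compose2[OF contl] continuous_on_compose2[OF cont\<Psi>])
          auto
      show "exp (l (\<Psi> (r, u)) - 2 * pi * \<i> * of_real (max 0 (min 1 u))) = 1" for u
        using l[of "\<Psi> (r, u)"] f\<Psi>[of r u] by (simp add: exp_diff)
    qed auto
    then obtain c where c: "\<And>u. l (\<Psi> (r, u)) - 2 * pi * \<i> * of_real (max 0 (min 1 u)) = c"
      unfolding constant_on_def by blast
    have "Im (l (\<Psi> (r, u))) = Im c + 2 * pi * max 0 (min 1 u)" for u
      using arg_cong[OF c[of u], of Im] by simp
    then show ?thesis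
      by blast
  qed
  have flow\<Psi>: "F t (\<Psi> (r, u)) = \<Psi> (r, u + t)" for t r u
    by (simp add: \<Psi>_def flow_add[OF F] algebra_simps)
  show thesis
  proof
    show "open V" "p \<in> V" by fact+
    show "continuous_on UNIV (\<lambda>x. - Im (l x))"
      by (intro continuous_intros contl)
    fix x and t :: real
    show "- Im (l (F t x)) \<le> - Im (l x)" if "0 \<le> t"
    proof (cases "x \<in> range \<Psi>")
      case True
      then obtain r u where "x = \<Psi> (r, u)"
        by auto
      moreover obtain c where "\<And>u. Im (l (\<Psi> (r, u))) = c + 2 * pi * max 0 (min 1 u)"
        using strip by blast
      ultimately show ?thesis
        using that by (simp add: flow\<Psi>)
    next
      case False
      \<comment> \<open>An orbit outside the range of \<open>\<Psi>\<close> never meets the strip,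
        so \<open>f\<close> is 1 along it and \<open>l\<close> is constant.\<close>
      have "F s x \<notin> S" for s
      proof
        assume "F s x \<in> S"
        then obtain r u where "F s x = \<Psi> (r, u)"
          by (auto simp: S_def)
        then have "F (- s) (F s x) = \<Psi> (r, u + - s)"
          by (simp add: flow\<Psi>)
        with False show False
          by (simp add: flow_add[OF F] flow_zero[OF F])
      qed
      then have "(\<lambda>s. l (F s x)) constant_on UNIV"
        by (intro exp_constant_imp_constant[where k = 1] contlF) (auto simp: l[symmetric] f_def)
      then have "l (F t x) = l (F 0 x)"
        unfolding constant_on_def by auto
      then show ?thesis
        by (simp add: flow_zero[OF F])
    qed
    show "- Im (l (F t x)) < - Im (l x)" if "x \<in> V" "0 < t"
    proof -
      obtain r u where "x = \<Psi> (r, u)" "0 < u" "u < 1"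
        using \<open>x \<in> V\<close> by (auto simp: V_def)
      moreover obtain c where "\<And>u. Im (l (\<Psi> (r, u))) = c + 2 * pi * max 0 (min 1 u)"
        using strip by blast
      ultimately show ?thesis
        using \<open>0 < t\<close> by (simp add: flow\<Psi>)
    qed
  qed
qed

section \<open>Gluing\<close>

text \<open>Since arctan is bounded and strictly increasing, the weighted series converges uniformly
  whatever the size of the \<open>L n\<close>, and it keeps a strict inequality in any single
  term.\<close>

lemma weighted_arctan_sum:
  fixes L :: "nat \<Rightarrow> 'a::topological_space \<Rightarrow> real"
  assumes "\<And>n. continuous_on UNIV (L n)"
  defines "\<Lambda> \<equiv> \<lambda>x. \<Sum>n. arctan (L n x) / 2 ^ n"
  shows "continuous_on UNIV \<Lambda>"
    and "\<And>x y n. (\<And>m. L m y \<le> L m x) \<Longrightarrow> L n y < L n x \<Longrightarrow> \<Lambda> y < \<Lambda> x"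
proof -
  have bound: "norm (arctan (L n x) / 2 ^ n) \<le> 2 * (1 / 2) ^ n" for n x
    using arctan_bounded[of "L n x"] pi_less_4
    by (auto simp: abs_le_iff power_one_over field_simps)
  have summable_bound: "summable (\<lambda>n. 2 * (1 / 2) ^ n :: real)"
    by (intro summable_mult summable_geometric) simp
  have "uniform_limit UNIV (\<lambda>n x. \<Sum>i<n. arctan (L i x) / 2 ^ i) \<Lambda> sequentially"
    unfolding \<Lambda>_def by (rule Weierstrass_m_test[OF bound summable_bound])
  then show "continuous_on UNIV \<Lambda>"
    by (rule uniform_limit_theorem[rotated])
      (auto intro!: always_eventually continuous_intros assms)
  have summable: "summable (\<lambda>n. arctan (L n x) / 2 ^ n)" for x
    using bound by (intro summable_comparison_test'[OF summable_bound])
  fix x y n assume le: "\<And>m. L m y \<le> L m x" and less: "L n y < L n x"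
  have "0 < (\<Sum>n. arctan (L n x) / 2 ^ n - arctan (L n y) / 2 ^ n)"
    by (rule suminf_pos2[where i = n])
      (auto intro!: summable_diff summable divide_right_mono divide_strict_right_mono
        simp: le less arctan_le_iff arctan_less_iff)
  then show "\<Lambda> y < \<Lambda> x"
    unfolding \<Lambda>_def suminf_diff[OF summable summable, symmetric] by simp
qed

theorem corollary4p14:
  fixes F :: "real \<Rightarrow> real^2 \<Rightarrow> real^2"
  assumes "regular_flow F"
  shows "\<exists>L :: real^2 \<Rightarrow> real. strict_Lyapunov F L"
proof -
  define good where "good V L \<longleftrightarrow> continuous_on UNIV L \<and> (\<forall>x t. 0 \<le> t \<longrightarrow> L (F t x) \<le> L x) \<and>
    (\<forall>x\<in>V. \<forall>t>0. L (F t x) < L x)" for V and L :: "real^2 \<Rightarrow> real"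
  \<comment> \<open>Passing to open sets that carry some good function allows the Lindelof property
    to reduce the point-dependent choices to countably many.\<close>
  define \<V> where "\<V> = {V. open V \<and> (\<exists>L. good V L)}"
  obtain \<W> where \<W>: "\<W> \<subseteq> \<V>" "countable \<W>" "\<Union>\<W> = \<Union>\<V>"
    using Lindelof[of \<V>] by (auto simp: \<V>_def)
  have "p \<in> \<Union>\<V>" for p
  proof (rule regular_flow_local_Lyapunov[OF assms, of p])
    fix V and L :: "real^2 \<Rightarrow> real"
    assume "open V" "p \<in> V" "continuous_on UNIV L"
      "\<And>x t. 0 \<le> t \<Longrightarrow> L (F t x) \<le> L x" "\<And>x t. x \<in> V \<Longrightarrow> 0 < t \<Longrightarrow> L (F t x) < L x"
    then have "good V L"
      by (simp add: good_def)
    with \<open>open V\<close> have "V \<in> \<V>"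
      by (auto simp: \<V>_def)
    with \<open>p \<in> V\<close> show ?thesis
      by (rule UnionI[rotated])
  qed
  then have cover: "\<Union>\<W> = UNIV"
    using \<W> by blast
  then have "\<W> \<noteq> {}"
    by auto
  \<comment> \<open>A finite \<open>\<W>\<close> is enumerated with repetitions, which do no harm in
    the sum.\<close>
  define W where "W = from_nat_into \<W>"
  have "W n \<in> \<V>" for n
    using from_nat_into[OF \<open>\<W> \<noteq> {}\<close>] \<W>(1) by (auto simp: W_def)
  then have "\<exists>L. good (W n) L" for n
    by (simp add: \<V>_def)
  then obtain L where L: "\<And>n. good (W n) (L n)"
    by metis
  have cont: "continuous_on UNIV (L n)" for n
    using L[of n] by (simp add: good_def)
  have "strict_Lyapunov F (\<lambda>x. \<Sum>n. arctan (L n x) / 2 ^ n)"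
    unfolding strict_Lyapunov_def
  proof (intro conjI allI impI)
    show "continuous_on UNIV (\<lambda>x. \<Sum>n. arctan (L n x) / 2 ^ n)"
      by (rule weighted_arctan_sum(1)[OF cont])
    fix x y assume "y \<in> forward_orbit F x \<and> y \<noteq> x"
    then obtain t where t: "y = F t x" "0 \<le> t" "F t x \<noteq> x"
      by (auto simp: forward_orbit_def)
    have "t \<noteq> 0"
      using t assms by (auto simp: regular_flow_def flow_zero)
    have "range W = \<W>"
      unfolding W_def by (rule range_from_nat_into[OF \<open>\<W> \<noteq> {}\<close> \<W>(2)])
    then obtain n where "x \<in> W n"
      using cover by (metis UNIV_I UnionE rangeE)
    show "(\<Sum>n. arctan (L n y) / 2 ^ n) < (\<Sum>n. arctan (L n x) / 2 ^ n)"
    proof (rule weighted_arctan_sum(2)[OF cont, where n = n])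
      show "L m y \<le> L m x" for m
        using L[of m] t by (simp add: good_def)
      show "L n y < L n x"
        using L[of n] t \<open>t \<noteq> 0\<close> \<open>x \<in> W n\<close> by (simp add: good_def)
    qed
  qed
  then show ?thesis
    by blast
qed

end
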